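(* Let $G=(V,E)$ be a finite connected graph with at least two vertices and maximal degree $\Delta$. Let $$\partial G = \left\{u \in V : \exists\, v \in V \text{ such that } \frac{1}{\deg(u)} \sum_{w:\,(u, w) \in E} d(w,v) < d(u,v) \right\}.$$ Then $$ | \partial G| \geq \frac{1}{2\Delta}\, \frac{|V|}{\operatorname{diam}(G)}.$$
   Context: Graphs are finite, simple and undirected. $d(\cdot,\cdot)$ is the graph distance (number of edges in a shortest path), $\deg(u)$ is the number of neighbors of $u$, and $\operatorname{diam}(G)=\max_{u,v\in V} d(u,v)$. The set $\partial G\subseteq V$ defined in the claim is called the boundary of $G$. *)

theory Defs
  imports "Graph_Theory.Graph_Theory"
begin

text \<open>
  A finite simple undirected graph is a \<^locale>\<open>graph\<close> of the AFP entry Graph_Theory: a finite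
  digraph without loops and parallel arcs whose adjacency relation is symmetric, so that each
  edge is represented by its two orientations.
\<close>

definition neighbors :: "('a, 'b) pre_digraph \<Rightarrow> 'a \<Rightarrow> 'a set" where
  "neighbors G u = {w. u \<rightarrow>\<^bsub>G\<^esub> w}"

definition deg :: "('a, 'b) pre_digraph \<Rightarrow> 'a \<Rightarrow> nat" where
  "deg G u = card (neighbors G u)"

definition max_degree :: "('a, 'b) pre_digraph \<Rightarrow> nat" where
  "max_degree G = Max (deg G ` verts G)"

text \<open>The value is meaningful only when \<open>v\<close> is reachable from \<open>u\<close>.\<close>

definition graph_dist :: "('a, 'b) pre_digraph \<Rightarrow> 'a \<Rightarrow> 'a \<Rightarrow> nat" where
  "graph_dist G u v = (LEAST n. \<exists>p. pre_digraph.apath G u p v \<and> length p = n)"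

definition graph_diameter :: "('a, 'b) pre_digraph \<Rightarrow> nat" where
  "graph_diameter G = Max {graph_dist G u v | u v. u \<in> verts G \<and> v \<in> verts G}"

definition graph_boundary :: "('a, 'b) pre_digraph \<Rightarrow> 'a set" where
  "graph_boundary G = {u \<in> verts G. \<exists>v \<in> verts G.
     1 / real (deg G u) * (\<Sum>w \<in> neighbors G u. real (graph_dist G w v)) < real (graph_dist G u v)}"

text \<open>
  Agreement with the degree and the (unit-weight) shortest-path distance of the library.
\<close>

lemma (in graph) deg_eq_out_degree: "deg G u = out_degree G u"
proof -
  have "neighbors G u = head G ` out_arcs G u"
    by (auto simp: neighbors_def out_arcs_def arcs_ends_conv)
  moreover have "inj_on (head G) (out_arcs G u)"
    by (auto simp: inj_on_def out_arcs_def arc_to_ends_def intro: no_multi_arcs)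
  ultimately show ?thesis
    by (simp add: deg_def out_degree_def card_image)
qed

lemma (in fin_digraph) graph_dist_eq_mu:
  assumes "u \<rightarrow>\<^sup>*\<^bsub>G\<^esub> v"
  shows "ereal (real (graph_dist G u v)) = \<mu> (\<lambda>_. 1) u v"
proof -
  have cost: "awalk_cost (\<lambda>_. 1) p = real (length p)" for p
    by (simp add: awalk_cost_def sum_list_triv)
  obtain p where p: "apath u p v" "\<mu> (\<lambda>_. 1) u v = ereal (awalk_cost (\<lambda>_. 1) p)"
    using no_neg_cyc_reach_imp_path[OF assms, of "\<lambda>_. 1"] by (auto simp: cost)
  have "graph_dist G u v = length p"
    unfolding graph_dist_def
  proof (rule Least_equality)
    show "\<exists>q. apath u q v \<and> length q = length p" using p(1) by blast
  next
    fix n assume "\<exists>q. apath u q v \<and> length q = n"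
    then obtain q where q: "apath u q v" "length q = n" by blast
    have "\<mu> (\<lambda>_. 1) u v \<le> ereal (awalk_cost (\<lambda>_. 1) q)"
      using q(1) by (intro min_cost_le_walk_cost) (simp add: apath_def)
    then show "length p \<le> n" using p(2) q(2) by (simp add: cost)
  qed
  then show ?thesis using p(2) by (simp add: cost)
qed

end

theory Submission
  imports Defs
begin

text \<open>
  Fix a vertex \<open>v\<close> and write \<open>d\<close> for the distance to \<open>v\<close>. Outside the boundary the mean of \<open>d\<close> over
  the neighbors of \<open>u\<close> is at least \<open>d u\<close>, and \<open>d\<close> changes by one along some edge at \<open>u\<close>, so the sum
  of \<open>d\<^sup>2 w - d\<^sup>2 u\<close> over the neighbors \<open>w\<close> of \<open>u\<close> is at least 1. On the boundary this sum is at least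
  \<open>- \<Delta> (2 diam - 1)\<close>, as \<open>d\<close> is 1-Lipschitz. Summed over all \<open>u\<close> these contributions cancel by
  symmetry, whence \<open>|V| - |\<partial>G| \<le> |\<partial>G| \<Delta> (2 diam - 1)\<close>.
\<close>

text \<open>\<open>graph_dist\<close> minimizes over paths, but prepending an arc to a path may give
  only a walk. The library's \<mu> with unit weights is a lower bound for the cost of every
  walk.\<close>

lemma (in fin_digraph) graph_dist_le_length:
  assumes "awalk u p v"
  shows "graph_dist G u v \<le> length p"
proof -
  have "\<mu> (\<lambda>_. 1) u v \<le> ereal (awalk_cost (\<lambda>_. 1) p)"
    using assms by (rule min_cost_le_walk_cost)
  moreover have "u \<rightarrow>\<^sup>* v"
    using assms by (rule reachable_awalkI)
  ultimately show ?thesis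
    by (simp add: graph_dist_eq_mu[symmetric] awalk_cost_def sum_list_triv)
qed

lemma (in fin_digraph) graph_dist_awalk:
  assumes "u \<rightarrow>\<^sup>* v"
  obtains p where "awalk u p v" "length p = graph_dist G u v"
proof -
  have "\<exists>n p. apath u p v \<and> length p = n"
    using assms by (auto simp: reachable_apath)
  then have "\<exists>p. apath u p v \<and> length p = graph_dist G u v"
    unfolding graph_dist_def by (rule LeastI_ex)
  then show thesis
    using that by (auto simp: apath_def)
qed

lemma (in fin_digraph) graph_dist_self: "u \<in> verts G \<Longrightarrow> graph_dist G u u = 0"
  using graph_dist_le_length[of u "[]" u] by (simp add: awalk_Nil_iff)

lemma (in fin_digraph) graph_dist_adj_le:
  assumes "u \<rightarrow>\<^bsub>G\<^esub> w" "w \<rightarrow>\<^sup>* v"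
  shows "graph_dist G u v \<le> Suc (graph_dist G w v)"
proof -
  obtain p where p: "awalk w p v" "length p = graph_dist G w v"
    using assms(2) by (rule graph_dist_awalk)
  obtain e where "e \<in> arcs G" "tail G e = u" "head G e = w"
    using assms(1) by (auto simp: arcs_ends_conv)
  then have "awalk u (e # p) v"
    using p(1) by (simp add: awalk_Cons_iff)
  from graph_dist_le_length[OF this] show ?thesis
    using p(2) by simp
qed

text \<open>Take the first arc of a shortest walk: its remaining arcs bound the distance from the
  head, and \<open>graph_dist_adj_le\<close> excludes anything smaller.\<close>

lemma (in fin_digraph) closer_neighbor:
  assumes "u \<rightarrow>\<^sup>* v" "u \<noteq> v"
  obtains w where "u \<rightarrow>\<^bsub>G\<^esub> w" "graph_dist G u v = Suc (graph_dist G w v)"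
proof -
  obtain p where p: "awalk u p v" "length p = graph_dist G u v"
    using assms(1) by (rule graph_dist_awalk)
  with assms(2) obtain e q where eq: "p = e # q"
    by (cases p) (auto simp: awalk_Nil_iff)
  then have e: "e \<in> arcs G" "tail G e = u" and q: "awalk (head G e) q v"
    using p(1) by (auto simp: awalk_Cons_iff)
  have adj: "u \<rightarrow>\<^bsub>G\<^esub> head G e"
    using in_arcs_imp_in_arcs_ends[OF e(1)] e(2) by simp
  have "graph_dist G (head G e) v \<le> length q"
    using q by (rule graph_dist_le_length)
  moreover have "graph_dist G u v \<le> Suc (graph_dist G (head G e) v)"
    using adj reachable_awalkI[OF q] by (rule graph_dist_adj_le)
  ultimately have "graph_dist G u v = Suc (graph_dist G (head G e) v)"
    using p(2) eq by simp
  with adj show thesis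
    by (rule that)
qed

lemma (in graph) neighbors_eq: "neighbors G u = {w \<in> verts G. u \<rightarrow>\<^bsub>G\<^esub> w}"
  by (auto simp: neighbors_def)

lemma (in graph) neighbors_eq': "neighbors G u = {w \<in> verts G. w \<rightarrow>\<^bsub>G\<^esub> u}"
  by (auto simp: neighbors_def intro: graph_symmetric)

lemma (in graph) finite_neighbors [simp]: "finite (neighbors G u)"
  by (simp add: neighbors_eq)

text \<open>Each edge is counted once in each orientation, with opposite signs.\<close>

lemma (in graph) sum_neighbors_diff_eq_0:
  fixes f :: "'a \<Rightarrow> 'c::ab_group_add"
  shows "(\<Sum>u\<in>verts G. \<Sum>w\<in>neighbors G u. f w - f u) = 0"
proof -
  have "(\<Sum>u\<in>verts G. \<Sum>w\<in>neighbors G u. f w) = (\<Sum>w\<in>verts G. \<Sum>u\<in>neighbors G w. f w)"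
    using sum.swap_restrict[of "verts G" "verts G" "\<lambda>u w. f w" "\<lambda>u w. u \<rightarrow>\<^bsub>G\<^esub> w"]
    by (simp flip: neighbors_eq neighbors_eq')
  then show ?thesis
    by (simp add: sum_subtractf)
qed

lemma (in graph) deg_le_max_degree: "u \<in> verts G \<Longrightarrow> deg G u \<le> max_degree G"
  unfolding max_degree_def by (rule Max_ge) auto

lemma (in graph) graph_dist_le_diameter:
  assumes "u \<in> verts G" "v \<in> verts G"
  shows "graph_dist G u v \<le> graph_diameter G"
proof -
  have "{graph_dist G u v | u v. u \<in> verts G \<and> v \<in> verts G}
      = (\<lambda>(u, v). graph_dist G u v) ` (verts G \<times> verts G)"
    by auto
  then have "finite {graph_dist G u v | u v. u \<in> verts G \<and> v \<in> verts G}"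
    by simp
  then show ?thesis
    unfolding graph_diameter_def using assms by (intro Max_ge) auto
qed

lemma (in graph) graph_boundary_subset: "graph_boundary G \<subseteq> verts G"
  by (auto simp: graph_boundary_def)

text \<open>With d the distance to \<open>v\<close>, split d(w)^2 - d(u)^2 = 2 d(u) (d(w) - d(u)) +
  (d(w) - d(u))^2. The linear terms have nonnegative sum off the boundary; one neighbor at distance
  d(u) \<plusminus> 1 makes the squares sum to at least 1.\<close>

lemma (in graph) sum_sq_diff_nonboundary:
  assumes conn: "strongly_connected G" and card: "card (verts G) \<ge> 2"
    and v: "v \<in> verts G" and u: "u \<in> verts G - graph_boundary G"
  shows "1 \<le> (\<Sum>w\<in>neighbors G u. real (graph_dist G w v)^2 - real (graph_dist G u v)^2)"
proof -
  let ?d = "\<lambda>w. real (graph_dist G w v)"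
  have reach: "x \<rightarrow>\<^sup>* y" if "x \<in> verts G" "y \<in> verts G" for x y
    using conn that unfolding strongly_connected_def by blast
  have "\<exists>z\<in>verts G. z \<noteq> u"
  proof (rule ccontr)
    assume "\<not> ?thesis"
    then have "verts G \<subseteq> {u}" by auto
    then have "card (verts G) \<le> 1" using card_mono[of "{u}" "verts G"] by simp
    then show False using card by simp
  qed
  then obtain z where z: "z \<in> verts G" "z \<noteq> u" by blast
  have "\<exists>w\<in>neighbors G u. (?d w - ?d u)^2 = 1"
  proof (cases "u = v")
    case False
    then obtain w where "u \<rightarrow>\<^bsub>G\<^esub> w" "graph_dist G u v = Suc (graph_dist G w v)"
      using closer_neighbor[of u v] reach u v by blast
    then show ?thesis
      by (intro bexI[of _ w]) (auto simp: neighbors_def)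
  next
    \<comment> \<open>No neighbor of \<open>v\<close> is closer to \<open>v\<close> than
      \<open>v\<close> itself. The second vertex \<open>z\<close> only supplies some neighbor, and
      any neighbor lies at distance exactly 1.\<close>
    case True
    obtain w where w: "u \<rightarrow>\<^bsub>G\<^esub> w"
      using closer_neighbor[of u z] reach u z by blast
    have "graph_dist G w v \<le> 1"
      using graph_dist_adj_le[of w u v] w v True
      by (auto simp: graph_dist_self intro: graph_symmetric)
    moreover have "w \<noteq> v"
      using w True adj_not_same by metis
    then have "graph_dist G w v \<noteq> 0"
      using closer_neighbor[of w v] reach w v by (metis adj_in_verts(2) nat.distinct(1))
    ultimately have "graph_dist G w v = 1" by linarith
    then show ?thesis
      using True v w by (intro bexI[of _ w]) (auto simp: neighbors_def graph_dist_self)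
  qed
  then obtain w where w: "w \<in> neighbors G u" "(?d w - ?d u)^2 = 1" by blast
  have sq: "1 \<le> (\<Sum>w\<in>neighbors G u. (?d w - ?d u)^2)"
    using member_le_sum[of w "neighbors G u" "\<lambda>w. (?d w - ?d u)^2"] w by simp
  have pos: "deg G u > 0"
    using w(1) by (auto simp: deg_def card_gt_0_iff)
  \<comment> \<open>This is non-membership in the boundary, read at the witness
    \<open>v\<close>.\<close>
  have "?d u \<le> 1 / real (deg G u) * (\<Sum>w\<in>neighbors G u. ?d w)"
    using u v by (auto simp: graph_boundary_def not_less)
  then have "real (deg G u) * ?d u \<le> (\<Sum>w\<in>neighbors G u. ?d w)"
    using pos by (simp add: field_simps)
  then have "0 \<le> (\<Sum>w\<in>neighbors G u. ?d w - ?d u)"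
    by (simp add: sum_subtractf deg_def)
  then have "0 \<le> 2 * ?d u * (\<Sum>w\<in>neighbors G u. ?d w - ?d u)"
    by simp
  with sq have "1 \<le> 2 * ?d u * (\<Sum>w\<in>neighbors G u. ?d w - ?d u)
      + (\<Sum>w\<in>neighbors G u. (?d w - ?d u)^2)"
    by linarith
  also have "\<dots> = (\<Sum>w\<in>neighbors G u. ?d w^2 - ?d u^2)"
    unfolding sum_distrib_left sum.distrib[symmetric]
    by (rule sum.cong) (auto simp: power2_eq_square algebra_simps)
  finally show ?thesis .
qed

text \<open>The worst neighbor is one step closer to \<open>v\<close>, costing (k-1)^2 - k^2 =
  -(2k-1) with k at most the diameter.\<close>

lemma (in graph) sum_sq_diff_ge:
  assumes conn: "strongly_connected G"
    and v: "v \<in> verts G" and u: "u \<in> verts G" and diam: "graph_diameter G \<ge> 1"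
  shows "- (real (max_degree G) * (2 * real (graph_diameter G) - 1))
    \<le> (\<Sum>w\<in>neighbors G u. real (graph_dist G w v)^2 - real (graph_dist G u v)^2)"
proof -
  let ?d = "\<lambda>w. real (graph_dist G w v)" and ?D = "real (graph_diameter G)"
  have le: "- (2 * ?D - 1) \<le> ?d w^2 - ?d u^2" if "w \<in> neighbors G u" for w
  proof (cases "graph_dist G u v")
    case 0
    then have "?d u^2 = 0" "0 \<le> ?d w^2" "1 \<le> ?D" using diam by auto
    then show ?thesis by linarith
  next
    case (Suc n)
    have uw: "u \<rightarrow>\<^bsub>G\<^esub> w" "w \<in> verts G"
      using that by (auto simp: neighbors_eq)
    have "w \<rightarrow>\<^sup>* v"
      using conn v uw(2) unfolding strongly_connected_def by blast
    from graph_dist_adj_le[OF uw(1) this] have "n \<le> graph_dist G w v"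
      using Suc by simp
    then have "(real n)^2 \<le> ?d w^2"
      by (intro power_mono) auto
    moreover have "real n + 1 \<le> ?D"
      using graph_dist_le_diameter[OF u v] Suc by linarith
    ultimately show ?thesis
      unfolding Suc by (simp add: power2_eq_square algebra_simps)
  qed
  \<comment> \<open>Enlarging the degree weakens the bound because 2 \<open>?D\<close> - 1 is
    nonnegative, by \<open>diam\<close>.\<close>
  have "real (deg G u) * (2 * ?D - 1) \<le> real (max_degree G) * (2 * ?D - 1)"
    using deg_le_max_degree[OF u] diam by (intro mult_right_mono) auto
  moreover have "(\<Sum>w\<in>neighbors G u. - (2 * ?D - 1)) \<le> (\<Sum>w\<in>neighbors G u. ?d w^2 - ?d u^2)"
    using le by (rule sum_mono)
  ultimately show ?thesis
    by (simp add: deg_def algebra_simps)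
qed

lemma (in graph) card_verts_le_boundary:
  assumes conn: "strongly_connected G" and card: "card (verts G) \<ge> 2"
    and deg: "max_degree G \<ge> 1" and diam: "graph_diameter G \<ge> 1"
  shows "real (card (verts G))
    \<le> 2 * real (max_degree G) * real (graph_diameter G) * real (card (graph_boundary G))"
proof -
  let ?B = "graph_boundary G" and ?\<Delta> = "real (max_degree G)" and ?D = "real (graph_diameter G)"
  \<comment> \<open>Any base vertex will do: a non-boundary vertex satisfies the mean inequality for
    every \<open>v\<close>.\<close>
  obtain v where v: "v \<in> verts G"
    using conn unfolding strongly_connected_def by blast
  define L where
    "L u = (\<Sum>w\<in>neighbors G u. real (graph_dist G w v)^2 - real (graph_dist G u v)^2)" for u
  have finB: "finite ?B"
    using graph_boundary_subset finite_verts by (rule finite_subset)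
  have "0 = sum L (verts G)"
    unfolding L_def by (rule sum_neighbors_diff_eq_0[symmetric])
  also have "\<dots> = sum L (verts G - ?B) + sum L ?B"
    by (rule sum.subset_diff[OF graph_boundary_subset finite_verts])
  also have "\<dots> \<ge> (\<Sum>u\<in>verts G - ?B. 1) + (\<Sum>u\<in>?B. - (?\<Delta> * (2 * ?D - 1)))"
    unfolding L_def
    using sum_sq_diff_nonboundary[OF conn card v] sum_sq_diff_ge[OF conn v _ diam]
      graph_boundary_subset
    by (intro add_mono sum_mono) auto
  finally have "real (card (verts G - ?B)) \<le> real (card ?B) * (?\<Delta> * (2 * ?D - 1))"
    by simp
  moreover have "card (verts G - ?B) + card ?B = card (verts G)"
    using card_Diff_subset[OF finB graph_boundary_subset]
      card_mono[OF finite_verts graph_boundary_subset] by simp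
  then have "real (card (verts G)) = real (card (verts G - ?B)) + real (card ?B)"
    by linarith
  ultimately have "real (card (verts G)) \<le> real (card ?B) * (?\<Delta> * (2 * ?D - 1) + 1)"
    by (simp add: algebra_simps)
  \<comment> \<open>The extra 1, from counting the boundary vertices themselves, is absorbed by
    -\<open>?\<Delta>\<close>, as \<open>?\<Delta>\<close> \<ge> 1.\<close>
  also have "\<dots> \<le> real (card ?B) * (2 * ?\<Delta> * ?D)"
    using deg by (intro mult_left_mono) (auto simp: algebra_simps)
  finally show ?thesis
    by (simp add: mult_ac)
qed

theorem theorem1:
  fixes G :: "('a, 'b) pre_digraph"
  assumes "graph G"
    and "Digraph_Component.connected G"
    and "card (verts G) \<ge> 2"
  shows "real (card (graph_boundary G))
           \<ge> 1 / (2 * real (max_degree G)) * (real (card (verts G)) / real (graph_diameter G))"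
proof -
  interpret graph G by fact
  have conn: "strongly_connected G"
    using sym_arcs assms(2) by (rule symmetric_connected_imp_strongly_connected)
  show ?thesis
  proof (cases "max_degree G = 0 \<or> graph_diameter G = 0")
    \<comment> \<open>Division by zero yields 0 in HOL, so the right-hand side vanishes.\<close>
    case True
    then show ?thesis by auto
  next
    case False
    then show ?thesis
      using card_verts_le_boundary[OF conn assms(3)] by (simp add: field_simps)
  qed
qed

end
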